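(* Let $X$ be a normed linear space, $A,B\subset X$, $a\in A$, $b\in B$, and define in $X\times X$ $$\tilde A:=A\times B,\quad\tilde B:=\{(x,x)\mid x\in X\},\quad\tilde a:=(a,b)\in\tilde A,\quad\tilde b:=(0,0)\in\tilde B.$$ (i) $\{A,B\}$ is extremal relative to $a$ and $b$ if and only if $\tilde a+\tilde b\in\mathrm{bd}(\tilde A+\tilde B)$. (ii) $\{A,B\}$ is locally extremal relative to $a$ and $b$ if and only if there exists a $\rho>0$ such that $\tilde a+\tilde b\in\mathrm{bd}\big(\tilde A+(\tilde B\cap(\rho\mathbb{B}))\big)$. (iii) $\{A,B\}$ is stationary relative to $a$ and $b$ if and only if for any $\varepsilon>0$ there exists a $\rho\in(0,\varepsilon)$ such that $\mathbb{B}_{\varepsilon\rho}(\tilde a+\tilde b)\not\subset\tilde A+(\tilde B\cap(\rho\mathbb{B}))$. (iv) $\{A,B\}$ is approximately stationary relative to $a$ and $b$ if and only if for any $\varepsilon>0$ there exist a $\rho\in(0,\varepsilon)$ and a point $\tilde a'\in\tilde A\cap\mathbb{B}_\varepsilon(\tilde a)$ such that $\mathbb{B}_{\varepsilon\rho}(\tilde a'+\tilde b)\not\subset\tilde A+(\tilde B\cap(\rho\mathbb{B}))$.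
   Context: The product $X\times X$ carries the maximum norm $\|(y,z)\|=\max\{\|y\|,\|z\|\}$. $\mathbb{B}$ denotes the closed unit ball (of $X\times X$ in the claim, of $X$ in the definitions below), $\rho\mathbb{B}$ is the closed ball of radius $\rho$ centered at the origin, and $\mathbb{B}_\delta(x)$ is the open ball of radius $\delta$ centered at $x$ (in the space containing $x$). $\mathrm{bd}$ denotes the topological boundary, and sums of sets are Minkowski sums. Definitions, for $a\in A$ and $b\in B$. The pair $\{A,B\}$ is: - extremal relative to $a$ and $b$ if for any $\varepsilon>0$ there are $u,v\in X$ with $(A-a-u)\cap(B-b-v)=\emptyset$ and $\max\{\|u\|,\|v\|\}<\varepsilon$; - locally extremal relative to $a$ and $b$ if there exists a $\rho>0$ such that for any $\varepsilon>0$ there are $u,v\in X$ with $(A-a-u)\cap(B-b-v)\cap(\rho\mathbb{B})=\emptyset$ and $\max\{\|u\|,\|v\|\}<\varepsilon$; - stationary relative to $a$ and $b$ if for any $\varepsilon>0$ there exist a $\rho\in(0,\varepsilon)$ and $u,v\in X$ with $(A-a-u)\cap(B-b-v)\cap(\rho\mathbb{B})=\emptyset$ and $\max\{\|u\|,\|v\|\}<\varepsilon\rho$; - approximately stationary relative to $a$ and $b$ if for any $\varepsilon>0$ there exist a $\rho\in(0,\varepsilon)$, points $a'\in A\cap\mathbb{B}_\varepsilon(a)$, $b'\in B\cap\mathbb{B}_\varepsilon(b)$ and $u,v\in X$ with $(A-a'-u)\cap(B-b'-v)\cap(\rho\mathbb{B})=\emptyset$ and $\max\{\|u\|,\|v\|\}<\varepsilon\rho$.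 *)

theory Defs
  imports "HOL-Analysis.Analysis" "HOL-Library.Set_Algebras"
begin

text \<open>
  The library norm on a product type is the Euclidean one, so the maximum norm
  and its open and closed balls are introduced separately.
\<close>

definition max_norm :: "'a::real_normed_vector \<times> 'b::real_normed_vector \<Rightarrow> real"
  where "max_norm p = max (norm (fst p)) (norm (snd p))"

definition max_ball :: "'a::real_normed_vector \<times> 'b::real_normed_vector \<Rightarrow> real \<Rightarrow> ('a \<times> 'b) set"
  where "max_ball c r = {p. max_norm (p - c) < r}"

definition max_cball :: "'a::real_normed_vector \<times> 'b::real_normed_vector \<Rightarrow> real \<Rightarrow> ('a \<times> 'b) set"
  where "max_cball c r = {p. max_norm (p - c) \<le> r}"

lemma max_ball_eq_Times: "max_ball c r = ball (fst c) r \<times> ball (snd c) r"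
  by (auto simp: max_ball_def max_norm_def dist_norm norm_minus_commute)

text \<open>
  The topology of a product type is the one induced by the maximum norm; hence
  \<^const>\<open>frontier\<close> is the boundary with respect to that norm.
\<close>

lemma open_iff_max_ball:
  fixes S :: "('a::real_normed_vector \<times> 'b::real_normed_vector) set"
  shows "open S \<longleftrightarrow> (\<forall>p\<in>S. \<exists>e>0. max_ball p e \<subseteq> S)"
proof
  assume S: "open S"
  show "\<forall>p\<in>S. \<exists>e>0. max_ball p e \<subseteq> S"
  proof
    fix p assume "p \<in> S"
    with S obtain U V where UV: "open U" "open V" "p \<in> U \<times> V" "U \<times> V \<subseteq> S"
      by (rule open_prod_elim)
    have "fst p \<in> U" "snd p \<in> V" using UV(3) by (simp_all add: mem_Times_iff)
    obtain d where d: "d > 0" "ball (fst p) d \<subseteq> U"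
      using \<open>open U\<close> \<open>fst p \<in> U\<close> by (rule openE)
    obtain e where e: "e > 0" "ball (snd p) e \<subseteq> V"
      using \<open>open V\<close> \<open>snd p \<in> V\<close> by (rule openE)
    have "ball (fst p) (min d e) \<subseteq> U" "ball (snd p) (min d e) \<subseteq> V"
      using subset_trans[OF subset_ball d(2)] subset_trans[OF subset_ball e(2)] by simp_all
    then have "max_ball p (min d e) \<subseteq> S"
      unfolding max_ball_eq_Times using UV(4) by (meson Sigma_mono subset_trans)
    then show "\<exists>e>0. max_ball p e \<subseteq> S"
      using d(1) e(1) by (meson min_less_iff_conj)
  qed
next
  assume *: "\<forall>p\<in>S. \<exists>e>0. max_ball p e \<subseteq> S"
  show "open S"
  proof (rule open_prod_intro)
    fix p assume "p \<in> S"
    with * obtain e where "e > 0" "max_ball p e \<subseteq> S" by blast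
    moreover have "p \<in> max_ball p e"
      using \<open>e > 0\<close> by (simp add: max_ball_eq_Times mem_Times_iff)
    ultimately show "\<exists>U V. open U \<and> open V \<and> p \<in> U \<times> V \<and> U \<times> V \<subseteq> S"
      unfolding max_ball_eq_Times using open_ball by blast
  qed
qed

definition extremal :: "'a::real_normed_vector set \<Rightarrow> 'a set \<Rightarrow> 'a \<Rightarrow> 'a \<Rightarrow> bool"
  where "extremal A B a b \<longleftrightarrow>
    (\<forall>\<epsilon>>0. \<exists>u v.
      (\<lambda>x. x - a - u) ` A \<inter> (\<lambda>x. x - b - v) ` B = {} \<and>
      max (norm u) (norm v) < \<epsilon>)"

definition locally_extremal :: "'a::real_normed_vector set \<Rightarrow> 'a set \<Rightarrow> 'a \<Rightarrow> 'a \<Rightarrow> bool"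
  where "locally_extremal A B a b \<longleftrightarrow>
    (\<exists>\<rho>>0. \<forall>\<epsilon>>0. \<exists>u v.
      (\<lambda>x. x - a - u) ` A \<inter> (\<lambda>x. x - b - v) ` B \<inter> cball 0 \<rho> = {} \<and>
      max (norm u) (norm v) < \<epsilon>)"

definition stationary :: "'a::real_normed_vector set \<Rightarrow> 'a set \<Rightarrow> 'a \<Rightarrow> 'a \<Rightarrow> bool"
  where "stationary A B a b \<longleftrightarrow>
    (\<forall>\<epsilon>>0. \<exists>\<rho>\<in>{0<..<\<epsilon>}. \<exists>u v.
      (\<lambda>x. x - a - u) ` A \<inter> (\<lambda>x. x - b - v) ` B \<inter> cball 0 \<rho> = {} \<and>
      max (norm u) (norm v) < \<epsilon> * \<rho>)"

definition approx_stationary :: "'a::real_normed_vector set \<Rightarrow> 'a set \<Rightarrow> 'a \<Rightarrow> 'a \<Rightarrow> bool"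
  where "approx_stationary A B a b \<longleftrightarrow>
    (\<forall>\<epsilon>>0. \<exists>\<rho>\<in>{0<..<\<epsilon>}. \<exists>a'\<in>A \<inter> ball a \<epsilon>. \<exists>b'\<in>B \<inter> ball b \<epsilon>. \<exists>u v.
      (\<lambda>x. x - a' - u) ` A \<inter> (\<lambda>x. x - b' - v) ` B \<inter> cball 0 \<rho> = {} \<and>
      max (norm u) (norm v) < \<epsilon> * \<rho>)"

end

theory Submission
  imports Defs
begin

text \<open>
  Everything rests on one observation about a single perturbation. A point $(a + u, b + v)$ fails
  to lie in $A \times B + \{(x, x) \mid x \in R\}$ exactly when no $p \in A$, $q \in B$, $x \in R$
  satisfy $p - a - u = -x = q - b - v$, which for $R = -R$ says that the translates $A - a - u$ and
  $B - b - v$ have no common point in $R$. Hence a pair of translations of size less than $r$ that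
  separates $A$ and $B$ within $R$ is the same thing as a point of the open maximum-norm ball of
  radius $r$ around $(a, b)$ that the sum set misses: this is
  \<open>small_separating_shift_iff\<close>. The four equivalences are this lemma with $R$ the
  whole space or a ball about the origin. In the two extremal cases the set $R$ stays
  fixed while the radius $r$ runs through all positive numbers; as the sum set contains $(a, b)$,
  missing a point of every such ball means that $(a, b)$ lies on its boundary.
\<close>

lemma shifts_disjoint_iff:
  fixes A B R :: "'a::real_normed_vector set"
  assumes symmetric: "\<And>x. x \<in> R \<Longrightarrow> - x \<in> R"
  shows "(\<lambda>x. x - a - u) ` A \<inter> (\<lambda>x. x - b - v) ` B \<inter> R = {} \<longleftrightarrow>
    (a + u, b + v) \<notin> A \<times> B + {(x, x) | x. x \<in> R}"
proof -
  have "(a + u, b + v) \<in> A \<times> B + {(x, x) | x. x \<in> R} \<longleftrightarrow>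
      (\<exists>x\<in>R. \<exists>p\<in>A. \<exists>q\<in>B. a + u = p + x \<and> b + v = q + x)"
    unfolding set_plus_def mem_Collect_eq by (simp add: Bex_def) blast
  also have "\<dots> \<longleftrightarrow> (\<exists>x\<in>R. \<exists>p\<in>A. \<exists>q\<in>B. - x = p - a - u \<and> - x = q - b - v)"
  proof -
    have "c + w = p + x \<longleftrightarrow> - x = p - c - w" for c w p x :: 'a
      by (auto simp: algebra_simps)
    then show ?thesis by simp
  qed
  also have "\<dots> \<longleftrightarrow> (\<exists>y\<in>uminus ` R. \<exists>p\<in>A. \<exists>q\<in>B. y = p - a - u \<and> y = q - b - v)"
    by simp
  also have "uminus ` R = R"
    using symmetric by (force simp: image_iff)
  also have "(\<exists>y\<in>R. \<exists>p\<in>A. \<exists>q\<in>B. y = p - a - u \<and> y = q - b - v) \<longleftrightarrow>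
      (\<lambda>x. x - a - u) ` A \<inter> (\<lambda>x. x - b - v) ` B \<inter> R \<noteq> {}"
    by blast
  finally show ?thesis by simp
qed

lemma small_separating_shift_iff:
  fixes A B R :: "'a::real_normed_vector set"
  assumes "\<And>x. x \<in> R \<Longrightarrow> - x \<in> R"
  shows "(\<exists>u v. (\<lambda>x. x - a - u) ` A \<inter> (\<lambda>x. x - b - v) ` B \<inter> R = {} \<and>
      max (norm u) (norm v) < r) \<longleftrightarrow>
    \<not> max_ball (a, b) r \<subseteq> A \<times> B + {(x, x) | x. x \<in> R}" (is "_ \<longleftrightarrow> \<not> _ \<subseteq> ?S")
proof -
  have "max_ball (a, b) r \<subseteq> ?S \<longleftrightarrow>
      (\<forall>u v. max (norm u) (norm v) < r \<longrightarrow> (a + u, b + v) \<in> ?S)"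
  proof
    assume "max_ball (a, b) r \<subseteq> ?S"
    then show "\<forall>u v. max (norm u) (norm v) < r \<longrightarrow> (a + u, b + v) \<in> ?S"
      by (auto simp: max_ball_def max_norm_def)
  next
    assume *: "\<forall>u v. max (norm u) (norm v) < r \<longrightarrow> (a + u, b + v) \<in> ?S"
    show "max_ball (a, b) r \<subseteq> ?S"
    proof (clarify)
      fix c d assume "(c, d) \<in> max_ball (a, b) r"
      then have "max (norm (c - a)) (norm (d - b)) < r"
        by (simp add: max_ball_def max_norm_def)
      with * have "(a + (c - a), b + (d - b)) \<in> ?S" by blast
      then show "(c, d) \<in> ?S" by simp
    qed
  qed
  moreover have "(\<lambda>x. x - a - u) ` A \<inter> (\<lambda>x. x - b - v) ` B \<inter> R = {} \<longleftrightarrow>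
      (a + u, b + v) \<notin> ?S" for u v
    by (rule shifts_disjoint_iff) (rule assms)
  ultimately show ?thesis by auto
qed

text \<open>
  Points of \<open>S\<close> belong to its closure, so being a boundary point is failing to be interior; that
  maximum-norm balls may test this is \<open>open_iff_max_ball\<close>.
\<close>

lemma frontier_iff_max_ball:
  fixes S :: "('a::real_normed_vector \<times> 'b::real_normed_vector) set"
  assumes "c \<in> S"
  shows "c \<in> frontier S \<longleftrightarrow> (\<forall>e>0. \<not> max_ball c e \<subseteq> S)"
proof -
  have "c \<in> interior S \<longleftrightarrow> (\<exists>e>0. max_ball c e \<subseteq> S)"
  proof
    assume "c \<in> interior S"
    then show "\<exists>e>0. max_ball c e \<subseteq> S"
      using open_interior[of S] interior_subset[of S] unfolding open_iff_max_ball by blast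
  next
    assume "\<exists>e>0. max_ball c e \<subseteq> S"
    then obtain e where "e > 0" and sub: "max_ball c e \<subseteq> S" by blast
    moreover have "open (max_ball c e)"
      by (simp add: max_ball_eq_Times open_Times)
    moreover have "c \<in> max_ball c e"
      using \<open>e > 0\<close> by (simp add: max_ball_eq_Times mem_Times_iff)
    ultimately show "c \<in> interior S" by (meson interiorI)
  qed
  moreover have "c \<in> closure S"
    using assms closure_subset by blast
  ultimately show ?thesis by (auto simp: frontier_def)
qed

theorem proposition15:
  fixes A B :: "'a::real_normed_vector set" and a b :: 'a
    and At Bt :: "('a \<times> 'a) set" and ab bt :: "'a \<times> 'a"
  assumes "a \<in> A" and "b \<in> B"
    and "At = A \<times> B" and "Bt = {(x, x) | x. x \<in> UNIV}"
    and "ab = (a, b)" and "bt = (0, 0)"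
  shows "(extremal A B a b \<longleftrightarrow> ab + bt \<in> frontier (At + Bt)) \<and>
    (locally_extremal A B a b \<longleftrightarrow>
      (\<exists>\<rho>>0. ab + bt \<in> frontier (At + (Bt \<inter> max_cball 0 \<rho>)))) \<and>
    (stationary A B a b \<longleftrightarrow>
      (\<forall>\<epsilon>>0. \<exists>\<rho>\<in>{0<..<\<epsilon>}.
        \<not> max_ball (ab + bt) (\<epsilon> * \<rho>) \<subseteq> At + (Bt \<inter> max_cball 0 \<rho>))) \<and>
    (approx_stationary A B a b \<longleftrightarrow>
      (\<forall>\<epsilon>>0. \<exists>\<rho>\<in>{0<..<\<epsilon>}. \<exists>ab'\<in>At \<inter> max_ball ab \<epsilon>.
        \<not> max_ball (ab' + bt) (\<epsilon> * \<rho>) \<subseteq> At + (Bt \<inter> max_cball 0 \<rho>)))"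
proof -
  let ?D = "\<lambda>R. {(x, x) | x. x \<in> R} :: ('a \<times> 'a) set"
  have diagonal_cball: "?D UNIV \<inter> max_cball 0 \<rho> = ?D (cball 0 \<rho>)" for \<rho>
    by (auto simp: max_cball_def max_norm_def)
  note shift_UNIV = small_separating_shift_iff[where R = UNIV, unfolded Int_UNIV_right, OF UNIV_I]
  have shift_cball: "(\<exists>u v. (\<lambda>x. x - c - u) ` A \<inter> (\<lambda>x. x - d - v) ` B \<inter> cball 0 \<rho> = {} \<and>
      max (norm u) (norm v) < r) \<longleftrightarrow> \<not> max_ball (c, d) r \<subseteq> A \<times> B + ?D (cball 0 \<rho>)" for c d \<rho> r
    by (rule small_separating_shift_iff) simp
  have base_point: "(a, b) \<in> A \<times> B + ?D R" if "0 \<in> R" for R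
  proof -
    have "(a, b) + (0, 0) \<in> A \<times> B + ?D R"
      by (rule set_plus_intro) (use assms(1,2) that in auto)
    then show ?thesis by simp
  qed
  have pairs: "(\<exists>c\<in>A \<times> B \<inter> max_ball (a, b) \<epsilon>. P c) \<longleftrightarrow>
      (\<exists>a'\<in>A \<inter> ball a \<epsilon>. \<exists>b'\<in>B \<inter> ball b \<epsilon>. P (a', b'))" for \<epsilon> P
    by (auto simp: max_ball_eq_Times)
  have translate_zero: "c + (0, 0) = c" for c :: "'a \<times> 'a"
    by (simp flip: zero_prod_def)
  have "extremal A B a b \<longleftrightarrow> (a, b) \<in> frontier (A \<times> B + ?D UNIV)"
    unfolding extremal_def frontier_iff_max_ball[OF base_point[OF UNIV_I]] shift_UNIV ..
  moreover have "locally_extremal A B a b \<longleftrightarrow>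
      (\<exists>\<rho>>0. (a, b) \<in> frontier (A \<times> B + ?D (cball 0 \<rho>)))"
    unfolding locally_extremal_def shift_cball
    by (intro ex_cong1 conj_cong refl frontier_iff_max_ball[OF base_point, symmetric]) simp
  moreover have "stationary A B a b \<longleftrightarrow> (\<forall>\<epsilon>>0. \<exists>\<rho>\<in>{0<..<\<epsilon>}.
      \<not> max_ball (a, b) (\<epsilon> * \<rho>) \<subseteq> A \<times> B + ?D (cball 0 \<rho>))"
    unfolding stationary_def shift_cball ..
  moreover have "approx_stationary A B a b \<longleftrightarrow>
      (\<forall>\<epsilon>>0. \<exists>\<rho>\<in>{0<..<\<epsilon>}. \<exists>c\<in>A \<times> B \<inter> max_ball (a, b) \<epsilon>.
        \<not> max_ball c (\<epsilon> * \<rho>) \<subseteq> A \<times> B + ?D (cball 0 \<rho>))"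
    unfolding approx_stationary_def shift_cball pairs ..
  ultimately show ?thesis
    unfolding assms(3-6) translate_zero diagonal_cball by blast
qed

end
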